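(* Fix a field $G$. Let $M=S^n$ with $n>2$, let $r\ge2$, and let $\mathcal{G}=\mathcal{G}^r(S^n)$ be the space of $C^r$ metrics on $S^n$. The map $\mathcal{G}\to\mathbb{R}$ given by $g\mapsto\overline{\alpha}_{g,G}$, where $\overline{\alpha}_{g,G}$ is the global mean frequency, is continuous.
   Context: $\mathcal{G}^r(M)$ is the set of $C^r$ Riemannian or Finsler metrics on $M$ with the $C^r$ topology. (In the paper's definition of $\mathcal{G}^r(M)$, $r\ge2$ for Riemannian metrics and $r\ge4$ for Finsler metrics.) Let $\Lambda=\Lambda S^n$ be the free loop space of $H^1$ maps $\gamma:\mathbb{R}/\mathbb{Z}\to S^n$, $F(\gamma)=\left(\int_0^1\|\gamma'(t)\|^2dt\right)^{1/2}$, and $\Lambda^{\le a}=\{F\le a\}$. For $X\in H_*(\Lambda;G)$ put $\mathrm{cr}(X)=\inf\{a\ge0: X\in\mathrm{im}(H_*(\Lambda^{\le a};G)\to H_*(\Lambda;G))\}$. For $n>2$ there is a unique real number $\overline{\alpha}_{g,G}>0$, called the global mean frequency, such that $\deg(X)-\overline{\alpha}_{g,G}\,\mathrm{cr}(X)$ is bounded over all nontrivial homogeneous $X\in H_*(\Lambda;G)$. *)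

theory Defs
  imports "HOL-Analysis.Analysis" "HOL-Homology.Homology" "HOL-Library.Set_Algebras"
begin

section \<open>Functions of class \<open>C\<^sup>r\<close> on open sets\<close>

primrec iterated_deriv :: "'b::real_normed_vector list \<Rightarrow> ('b \<Rightarrow> real) \<Rightarrow> 'b \<Rightarrow> real" where
  "iterated_deriv [] f = f"
| "iterated_deriv (u # us) f = (\<lambda>z. frechet_derivative (iterated_deriv us f) (at z) u)"

definition Cr_on :: "nat \<Rightarrow> 'b::euclidean_space set \<Rightarrow> ('b \<Rightarrow> real) \<Rightarrow> bool" where
  "Cr_on r U f \<longleftrightarrow>
     (\<forall>us. set us \<subseteq> Basis \<and> length us \<le> r \<longrightarrow>
        continuous_on U (iterated_deriv us f) \<and>
        (length us < r \<longrightarrow> (\<forall>z\<in>U. iterated_deriv us f differentiable (at z))))"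


section \<open>Riemannian and Finsler metrics on the unit sphere\<close>

text \<open>The sphere is the unit sphere of a Euclidean space, and a metric (Riemannian or Finsler)
  is given by its norm function on the tangent bundle, extended by \<open>undefined\<close> outside of it;
  a Riemannian metric \<open>g\<close> is thus identified with \<open>(x, v) \<mapsto> sqrt (g x v v)\<close>.\<close>

definition tangent_bundle :: "('a::euclidean_space \<times> 'a) set" where
  "tangent_bundle = {(x, v). x \<in> sphere 0 1 \<and> x \<bullet> v = 0}"

definition slit_tangent_bundle :: "('a::euclidean_space \<times> 'a) set" where
  "slit_tangent_bundle = {(x, v) \<in> tangent_bundle. v \<noteq> 0}"

definition tangent_proj :: "'a::euclidean_space \<Rightarrow> 'a \<Rightarrow> 'a" where
  "tangent_proj x v = v - ((x \<bullet> v) / (x \<bullet> x)) *\<^sub>R x"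

text \<open>Composition with the smooth submersion \<open>bundle_retraction\<close>, defined for \<open>x \<noteq> 0\<close>, turns a
  function on the slit tangent bundle into a function on an open subset of the ambient space.
  Since the retraction is the identity on the bundle, the former is of class \<open>C\<^sup>r\<close> on the manifold
  if and only if the latter is of class \<open>C\<^sup>r\<close> on the open set.\<close>

definition bundle_retraction :: "'a::euclidean_space \<times> 'a \<Rightarrow> 'a \<times> 'a" where
  "bundle_retraction = (\<lambda>(x, v). (x /\<^sub>R norm x, tangent_proj x v))"

definition slit_domain :: "('a::euclidean_space \<times> 'a) set" where
  "slit_domain = {(x, v). x \<noteq> 0 \<and> tangent_proj x v \<noteq> 0}"

definition ambient :: "('a::euclidean_space \<times> 'a \<Rightarrow> real) \<Rightarrow> 'a \<times> 'a \<Rightarrow> real" where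
  "ambient F = F \<circ> bundle_retraction"

text \<open>The bilinear form on \<open>T\<^sub>xS\<close> is taken to be the restriction of one on the whole space;
  only its values on \<open>T\<^sub>xS\<close> matter.\<close>

definition riemannian_metric :: "nat \<Rightarrow> ('a::euclidean_space \<times> 'a \<Rightarrow> real) \<Rightarrow> bool" where
  "riemannian_metric r F \<longleftrightarrow>
     F \<in> extensional tangent_bundle \<and>
     (\<exists>g. (\<forall>x\<in>sphere 0 1. bilinear (g x)) \<and>
          (\<forall>x\<in>sphere 0 1. \<forall>u v. x \<bullet> u = 0 \<and> x \<bullet> v = 0 \<longrightarrow> g x u v = g x v u) \<and>
          (\<forall>x\<in>sphere 0 1. \<forall>v. x \<bullet> v = 0 \<and> v \<noteq> 0 \<longrightarrow> g x v v > 0) \<and>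
          (\<forall>u v. Cr_on r (- {0})
             (\<lambda>x. g (x /\<^sub>R norm x) (tangent_proj x u) (tangent_proj x v))) \<and>
          (\<forall>(x, v)\<in>tangent_bundle. F (x, v) = sqrt (g x v v)))"

definition fundamental_tensor ::
    "('a::euclidean_space \<times> 'a \<Rightarrow> real) \<Rightarrow> 'a \<Rightarrow> 'a \<Rightarrow> 'a \<Rightarrow> 'a \<Rightarrow> real" where
  "fundamental_tensor F x v u w =
     deriv (\<lambda>s. deriv (\<lambda>t. (F (x, v + s *\<^sub>R u + t *\<^sub>R w))\<^sup>2) 0) 0 / 2"

definition finsler_metric :: "nat \<Rightarrow> ('a::euclidean_space \<times> 'a \<Rightarrow> real) \<Rightarrow> bool" where
  "finsler_metric r F \<longleftrightarrow>
     F \<in> extensional tangent_bundle \<and>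
     Cr_on r slit_domain (ambient F) \<and>
     (\<forall>z\<in>slit_tangent_bundle. F z > 0) \<and>
     (\<forall>(x, v)\<in>tangent_bundle. \<forall>c\<ge>0. F (x, c *\<^sub>R v) = c * F (x, v)) \<and>
     (\<forall>(x, v)\<in>slit_tangent_bundle. \<forall>w. x \<bullet> w = 0 \<and> w \<noteq> 0 \<longrightarrow> fundamental_tensor F x v w w > 0)"

definition metrics :: "nat \<Rightarrow> ('a::euclidean_space \<times> 'a \<Rightarrow> real) set" where
  "metrics r = {F. 2 \<le> r \<and> riemannian_metric r F \<or> 4 \<le> r \<and> finsler_metric r F}"

text \<open>Uniform convergence of all derivatives of order at most \<open>r\<close> on compact subsets of the slit
  tangent bundle. For Riemannian metrics this is the \<open>C\<^sup>r\<close> topology on metric tensors, because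
  \<open>g\<close> and its derivatives are recovered by polarization from \<open>F\<^sup>2\<close>, and \<open>F > 0\<close>
  off the zero section.\<close>

definition metrics_topology :: "nat \<Rightarrow> ('a::euclidean_space \<times> 'a \<Rightarrow> real) topology" where
  "metrics_topology r = topology_generated_by
     {{F' \<in> metrics r. \<forall>us. set us \<subseteq> Basis \<and> length us \<le> r \<longrightarrow>
          (\<forall>z\<in>K. \<bar>iterated_deriv us (ambient F') z - iterated_deriv us (ambient F) z\<bar> < e)}
      | F K e. F \<in> metrics r \<and> compact K \<and> K \<subseteq> slit_tangent_bundle \<and> 0 < e}"


section \<open>The free loop space\<close>

abbreviation velocity :: "(real \<Rightarrow> 'a::euclidean_space) \<Rightarrow> real \<Rightarrow> 'a" where
  "velocity \<gamma> t \<equiv> vector_derivative \<gamma> (at t)"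

text \<open>Maps from \<open>\<real>/\<int>\<close> are \<open>1\<close>-periodic functions on the line. The conditions on the derivative say
  that \<open>\<gamma>\<close> is absolutely continuous with square integrable derivative.\<close>

definition loops :: "(real \<Rightarrow> 'a::euclidean_space) set" where
  "loops = {\<gamma>. (\<forall>t. \<gamma> (t + 1) = \<gamma> t) \<and> (\<forall>t. \<gamma> t \<in> sphere 0 1) \<and>
     (AE t in lebesgue. \<gamma> differentiable (at t)) \<and>
     set_integrable lebesgue {0..1} (velocity \<gamma>) \<and>
     (\<forall>t\<in>{0..1}. \<gamma> t = \<gamma> 0 + (LINT s:{0..t}|lebesgue. velocity \<gamma> s)) \<and>
     set_integrable lebesgue {0..1} (\<lambda>t. (norm (velocity \<gamma> t))\<^sup>2)}"

definition loop_dist :: "(real \<Rightarrow> 'a::euclidean_space) \<Rightarrow> (real \<Rightarrow> 'a) \<Rightarrow> real" where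
  "loop_dist \<gamma> \<delta> = sqrt (LINT t:{0..1}|lebesgue.
      (norm (\<gamma> t - \<delta> t))\<^sup>2 + (norm (velocity \<gamma> t - velocity \<delta> t))\<^sup>2)"

definition loop_space :: "(real \<Rightarrow> 'a::euclidean_space) topology" where
  "loop_space = topology_generated_by
     {{\<delta> \<in> loops. loop_dist \<gamma> \<delta> < e} | \<gamma> e. \<gamma> \<in> loops \<and> 0 < e}"

definition sqrt_energy :: "('a::euclidean_space \<times> 'a \<Rightarrow> real) \<Rightarrow> (real \<Rightarrow> 'a) \<Rightarrow> real" where
  "sqrt_energy F \<gamma> = sqrt (LINT t:{0..1}|lebesgue. (F (\<gamma> t, velocity \<gamma> t))\<^sup>2)"

definition sublevel :: "('a::euclidean_space \<times> 'a \<Rightarrow> real) \<Rightarrow> real \<Rightarrow> (real \<Rightarrow> 'a) topology" where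
  "sublevel F a = subtopology loop_space {\<gamma>. sqrt_energy F \<gamma> \<le> a}"


section \<open>Singular homology with coefficients\<close>

text \<open>The library's singular chains have integer coefficients; this is the same complex over a
  field \<open>'g\<close>.\<close>

type_synonym ('x, 'g) gchain = "((nat \<Rightarrow> real) \<Rightarrow> 'x) \<Rightarrow>\<^sub>0 'g"

definition gchains :: "nat \<Rightarrow> 'x topology \<Rightarrow> ('x, 'g::field) gchain set" where
  "gchains p X = {c. Poly_Mapping.keys c \<subseteq> singular_simplex_set p X}"

definition gboundary :: "nat \<Rightarrow> ('x, 'g::field) gchain \<Rightarrow> ('x, 'g) gchain" where
  "gboundary p c = (if p = 0 then 0 else
     (\<Sum>f\<in>Poly_Mapping.keys c. \<Sum>k\<le>p.
        Poly_Mapping.single (singular_face p k f) ((-1) ^ k * Poly_Mapping.lookup c f)))"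

definition gcycles :: "nat \<Rightarrow> 'x topology \<Rightarrow> ('x, 'g::field) gchain set" where
  "gcycles p X = {c \<in> gchains p X. gboundary p c = 0}"

definition gboundaries :: "nat \<Rightarrow> 'x topology \<Rightarrow> ('x, 'g::field) gchain set" where
  "gboundaries p X = gboundary (Suc p) ` gchains (Suc p) X"

text \<open>Homology classes are cosets \<open>z +o gboundaries p X\<close> of cycles, and the zero class is
  \<open>gboundaries p X\<close> itself.\<close>

definition ghomology :: "nat \<Rightarrow> 'x topology \<Rightarrow> ('x, 'g::field) gchain set set" where
  "ghomology p X = (\<lambda>z. z +o gboundaries p X) ` gcycles p X"

text \<open>The homomorphism induced by the inclusion of a subspace into \<open>X\<close>.\<close>

definition ghom_incl ::
    "nat \<Rightarrow> 'x topology \<Rightarrow> ('x, 'g::field) gchain set \<Rightarrow> ('x, 'g) gchain set" where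
  "ghom_incl p X Y = Y + gboundaries p X"


section \<open>Critical levels and the global mean frequency\<close>

definition critical_level ::
    "('a::euclidean_space \<times> 'a \<Rightarrow> real) \<Rightarrow> nat \<Rightarrow> (real \<Rightarrow> 'a, 'g::field) gchain set \<Rightarrow> real" where
  "critical_level F p X =
     Inf {a. 0 \<le> a \<and> X \<in> ghom_incl p loop_space ` ghomology p (sublevel F a)}"

definition resonant ::
    "'g::field itself \<Rightarrow> ('a::euclidean_space \<times> 'a \<Rightarrow> real) \<Rightarrow> real \<Rightarrow> bool" where
  "resonant G F \<alpha> \<longleftrightarrow> 0 < \<alpha> \<and>
     bounded {real p - \<alpha> * critical_level F p X | p X.
        X \<in> (ghomology p loop_space :: (real \<Rightarrow> 'a, 'g) gchain set set) \<and>
        X \<noteq> gboundaries p loop_space}"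

definition is_global_mean_frequency ::
    "'g::field itself \<Rightarrow> ('a::euclidean_space \<times> 'a \<Rightarrow> real) \<Rightarrow> real \<Rightarrow> bool" where
  "is_global_mean_frequency G F \<alpha> \<longleftrightarrow> resonant G F \<alpha> \<and> (\<forall>\<beta>. resonant G F \<beta> \<longrightarrow> \<beta> = \<alpha>)"

end

theory Submission
  imports Defs
begin

text \<open>A metric \<open>F'\<close> near \<open>F\<close> is uniformly close to it on the compact unit tangent bundle, hence by
  homogeneity \<open>(1 - \<epsilon>) F \<le> F' \<le> (1 + \<epsilon>) F\<close> on all tangent vectors. The same inequalities pass to
  the square root of the energy, so sublevel sets are nested and the critical levels of every
  class \<open>X\<close> satisfy \<open>\<bar>cr' X - cr X\<bar> \<le> \<epsilon> \<bar>cr X\<bar>\<close>. Uniqueness of the mean frequency of \<open>F\<close> forces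
  \<open>cr\<close> to be unbounded over the nontrivial classes, and dividing the two resonance estimates by
  \<open>cr X \<rightarrow> \<infinity>\<close> gives \<open>\<bar>\<alpha>' - \<alpha>\<bar> \<le> \<epsilon> \<alpha>'\<close>.\<close>

section \<open>Metrics as functions on the tangent bundle\<close>

lemma slit_tangent_bundle_subset: "slit_tangent_bundle \<subseteq> tangent_bundle"
  by (auto simp: slit_tangent_bundle_def)

lemma tangent_proj_tangent: "x \<bullet> v = 0 \<Longrightarrow> tangent_proj x v = v"
  by (simp add: tangent_proj_def)

lemma linear_tangent_proj: "linear (tangent_proj x)"
  by (rule linearI) (simp_all add: tangent_proj_def inner_right_distrib add_divide_distrib algebra_simps)

lemma ambient_slit_tangent_bundle: "z \<in> slit_tangent_bundle \<Longrightarrow> ambient F z = F z"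
  by (auto simp: ambient_def bundle_retraction_def slit_tangent_bundle_def tangent_bundle_def
      tangent_proj_tangent)

lemma slit_tangent_bundle_subset_slit_domain: "slit_tangent_bundle \<subseteq> slit_domain"
  by (auto simp: slit_tangent_bundle_def tangent_bundle_def slit_domain_def tangent_proj_tangent)

lemma Cr_on_imp_continuous_on: "Cr_on r U f \<Longrightarrow> continuous_on U f"
  unfolding Cr_on_def by (auto dest: spec[of _ "[]"])

text \<open>The regularity hypothesis on a Riemannian metric speaks only of the coefficients
  \<open>g x (tangent_proj x u) (tangent_proj x v)\<close> with \<open>u\<close> and
  \<open>v\<close> fixed. Since the projection fixes a tangent vector, projecting its expansion in
  the ambient basis expresses the quadratic form through finitely many of these
  coefficients.\<close>

lemma bilinear_tangent_expansion:
  assumes "bilinear b" and "x \<bullet> v = 0"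
  shows "b v v = (\<Sum>i\<in>Basis. \<Sum>j\<in>Basis. (v \<bullet> i) * (v \<bullet> j) * b (tangent_proj x i) (tangent_proj x j))"
proof -
  have "tangent_proj x v = tangent_proj x (\<Sum>i\<in>Basis. (v \<bullet> i) *\<^sub>R i)"
    by (simp add: euclidean_representation)
  then have v: "v = (\<Sum>i\<in>Basis. (v \<bullet> i) *\<^sub>R tangent_proj x i)"
    using assms(2) by (simp add: tangent_proj_tangent linear_sum[OF linear_tangent_proj]
        linear_scale[OF linear_tangent_proj])
  have "b v v = b (\<Sum>i\<in>Basis. (v \<bullet> i) *\<^sub>R tangent_proj x i) (\<Sum>i\<in>Basis. (v \<bullet> i) *\<^sub>R tangent_proj x i)"
    using v by simp
  also have "\<dots> = (\<Sum>i\<in>Basis. \<Sum>j\<in>Basis. (v \<bullet> i) * (v \<bullet> j) * b (tangent_proj x i) (tangent_proj x j))"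
    using assms(1)
    by (simp add: bilinear_sum sum.cartesian_product bilinear_lmul bilinear_rmul mult.assoc)
  finally show ?thesis .
qed

lemma continuous_on_riemannian_metric:
  assumes "riemannian_metric r F"
  shows "continuous_on tangent_bundle F"
proof -
  obtain g where bil: "\<And>x. x \<in> sphere 0 1 \<Longrightarrow> bilinear (g x)"
    and cr: "\<And>u v. Cr_on r (- {0}) (\<lambda>x. g (x /\<^sub>R norm x) (tangent_proj x u) (tangent_proj x v))"
    and F: "\<And>x v. (x, v) \<in> tangent_bundle \<Longrightarrow> F (x, v) = sqrt (g x v v)"
    using assms unfolding riemannian_metric_def by blast
  have "continuous_on tangent_bundle
      (\<lambda>z. g (fst z /\<^sub>R norm (fst z)) (tangent_proj (fst z) i) (tangent_proj (fst z) j))" for i j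
    by (rule continuous_on_compose2[OF Cr_on_imp_continuous_on[OF cr[of i j]]])
      (auto intro!: continuous_intros simp: tangent_bundle_def)
  then have "continuous_on tangent_bundle (\<lambda>z. sqrt (\<Sum>i\<in>Basis. \<Sum>j\<in>Basis. (snd z \<bullet> i) * (snd z \<bullet> j) *
      g (fst z /\<^sub>R norm (fst z)) (tangent_proj (fst z) i) (tangent_proj (fst z) j)))"
    by (intro continuous_intros)
  moreover have "sqrt (\<Sum>i\<in>Basis. \<Sum>j\<in>Basis. (snd z \<bullet> i) * (snd z \<bullet> j) *
      g (fst z /\<^sub>R norm (fst z)) (tangent_proj (fst z) i) (tangent_proj (fst z) j)) = F z"
    if "z \<in> tangent_bundle" for z
  proof -
    obtain x v where z: "z = (x, v)" by fastforce
    with that have x: "x \<in> sphere 0 1" "x \<bullet> v = 0" by (auto simp: tangent_bundle_def)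
    show ?thesis
      using that x bilinear_tangent_expansion[OF bil[OF x(1)] x(2)] by (simp add: z F)
  qed
  ultimately show ?thesis
    by (simp cong: continuous_on_cong)
qed

text \<open>The zero section is left out because a Finsler metric is assumed regular only away from
  it.\<close>

lemma continuous_on_metric:
  assumes "F \<in> metrics r"
  shows "continuous_on slit_tangent_bundle F"
proof -
  consider "riemannian_metric r F" | "finsler_metric r F"
    using assms by (auto simp: metrics_def)
  then show ?thesis
  proof cases
    case 1
    then show ?thesis
      using continuous_on_riemannian_metric continuous_on_subset slit_tangent_bundle_subset by blast
  next
    case 2
    then have "continuous_on slit_tangent_bundle (ambient F)"
      by (meson Cr_on_imp_continuous_on continuous_on_subset finsler_metric_def
          slit_tangent_bundle_subset_slit_domain)
    then show ?thesis
      by (simp add: ambient_slit_tangent_bundle cong: continuous_on_cong)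
  qed
qed

lemma metric_pos:
  assumes "F \<in> metrics r" and "z \<in> slit_tangent_bundle"
  shows "F z > 0"
proof -
  consider "riemannian_metric r F" | "finsler_metric r F"
    using assms(1) by (auto simp: metrics_def)
  then show ?thesis
  proof cases
    case 1
    then show ?thesis
      using assms(2) unfolding riemannian_metric_def slit_tangent_bundle_def tangent_bundle_def
      by auto
  next
    case 2
    then show ?thesis
      using assms(2) by (simp add: finsler_metric_def)
  qed
qed

lemma metric_homogeneous:
  assumes "F \<in> metrics r" and "(x, v) \<in> tangent_bundle" and "c \<ge> 0"
  shows "F (x, c *\<^sub>R v) = c * F (x, v)"
proof -
  consider "riemannian_metric r F" | "finsler_metric r F"
    using assms(1) by (auto simp: metrics_def)
  then show ?thesis
  proof cases
    case 1
    then obtain g where bil: "\<And>x. x \<in> sphere 0 1 \<Longrightarrow> bilinear (g x)"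
      and F: "\<And>x v. (x, v) \<in> tangent_bundle \<Longrightarrow> F (x, v) = sqrt (g x v v)"
      unfolding riemannian_metric_def by blast
    have x: "bilinear (g x)" "(x, c *\<^sub>R v) \<in> tangent_bundle"
      using assms(2) by (auto simp: tangent_bundle_def intro!: bil)
    then have "F (x, c *\<^sub>R v) = sqrt (c\<^sup>2 * g x v v)"
      by (simp add: F bilinear_lmul bilinear_rmul power2_eq_square mult.assoc)
    then show ?thesis
      using assms(2,3) by (simp add: F real_sqrt_mult)
  next
    case 2
    then show ?thesis
      using assms(2,3) unfolding finsler_metric_def by blast
  qed
qed

lemma metric_zero:
  assumes "F \<in> metrics r" and "x \<in> sphere 0 1"
  shows "F (x, 0) = 0"
  using metric_homogeneous[OF assms(1), of x 0 0] assms(2) by (simp add: tangent_bundle_def)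

lemma metric_nonneg:
  assumes "F \<in> metrics r" and "z \<in> tangent_bundle"
  shows "F z \<ge> 0"
proof (cases "z \<in> slit_tangent_bundle")
  case True
  then show ?thesis using metric_pos[OF assms(1)] by fastforce
next
  case False
  then show ?thesis
    using assms metric_zero[OF assms(1)]
    by (auto simp: slit_tangent_bundle_def tangent_bundle_def)
qed

section \<open>Compactness of the unit tangent bundle and homogeneity\<close>

definition unit_tangent_bundle :: "('a::euclidean_space \<times> 'a) set" where
  "unit_tangent_bundle = {(x, v) \<in> tangent_bundle. norm v = 1}"

lemma unit_tangent_bundle_subset: "unit_tangent_bundle \<subseteq> slit_tangent_bundle"
  by (auto simp: unit_tangent_bundle_def slit_tangent_bundle_def)

lemma closed_tangent_bundle: "closed (tangent_bundle :: ('a::euclidean_space \<times> 'a) set)"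
proof -
  have "tangent_bundle = {z::'a \<times> 'a. norm (fst z) = 1} \<inter> {z. fst z \<bullet> snd z = 0}"
    by (auto simp: tangent_bundle_def)
  moreover have "closed \<dots>"
    by (intro closed_Int closed_Collect_eq continuous_intros)
  ultimately show ?thesis
    by (simp only:)
qed

text \<open>A difference of two closed sets. This makes the extension of \<open>F\<close> squared by
  zero Borel, which the measurability of the energy integrand rests on.\<close>

lemma borel_slit_tangent_bundle:
  "(slit_tangent_bundle :: ('a::euclidean_space \<times> 'a) set) \<in> sets borel"
proof -
  have "slit_tangent_bundle = tangent_bundle - {z. snd z = 0}"
    by (auto simp: slit_tangent_bundle_def)
  moreover have "closed {z::'a \<times> 'a. snd z = 0}"
    by (intro closed_Collect_eq continuous_intros)
  ultimately show ?thesis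
    using closed_tangent_bundle by (metis borel_closed sets.Diff)
qed

lemma compact_unit_tangent_bundle:
  "compact (unit_tangent_bundle :: ('a::euclidean_space \<times> 'a) set)"
proof -
  have "unit_tangent_bundle = tangent_bundle \<inter> (sphere (0::'a) 1 \<times> sphere 0 1)"
    by (auto simp: unit_tangent_bundle_def tangent_bundle_def)
  moreover have "compact \<dots>"
    by (intro closed_Int_compact compact_Times closed_tangent_bundle compact_sphere)
  ultimately show ?thesis
    by (simp only:)
qed

text \<open>Both sides are homogeneous of degree one in the vector, so the inequality scales from
  unit vectors to nonzero ones; on the zero section both sides vanish.\<close>

lemma metric_mono_unit_tangent_bundle:
  assumes "F \<in> metrics r" and "F' \<in> metrics r"
    and le: "\<And>z. z \<in> unit_tangent_bundle \<Longrightarrow> F' z \<le> k * F z"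
    and z: "z \<in> tangent_bundle"
  shows "F' z \<le> k * F z"
proof -
  obtain x v where xv: "z = (x, v)" by fastforce
  show ?thesis
  proof (cases "v = 0")
    case True
    then show ?thesis
      using z xv metric_zero[OF assms(1)] metric_zero[OF assms(2)] by (auto simp: tangent_bundle_def)
  next
    case False
    then have u: "(x, v /\<^sub>R norm v) \<in> unit_tangent_bundle"
      using z xv by (auto simp: tangent_bundle_def unit_tangent_bundle_def)
    then have t: "(x, v /\<^sub>R norm v) \<in> tangent_bundle"
      by (auto simp: unit_tangent_bundle_def)
    have "G z = norm v * G (x, v /\<^sub>R norm v)" if "G \<in> metrics r" for G
      using metric_homogeneous[OF that t, of "norm v"] False xv by simp
    then show ?thesis
      using mult_left_mono[OF le[OF u] norm_ge_zero[of v]] assms(1,2)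
      by (simp add: mult.left_commute)
  qed
qed

text \<open>A positive minimum on a compact set is what converts the additive closeness built into
  the topology into closeness relative to \<open>F\<close>.\<close>

lemma metric_lower_bound:
  assumes "F \<in> metrics r"
  obtains m where "m > 0" and "\<And>z. z \<in> unit_tangent_bundle \<Longrightarrow> m \<le> F z"
proof (cases "unit_tangent_bundle = ({} :: ('a \<times> 'a) set)")
  \<comment> \<open>In ambient dimension one the tangent spaces are trivial, so there is no unit
    vector and no minimum to take.\<close>
  case True
  then show ?thesis using that[of 1] by auto
next
  case False
  obtain z0 where "z0 \<in> unit_tangent_bundle" "\<And>z. z \<in> unit_tangent_bundle \<Longrightarrow> F z0 \<le> F z"
    using continuous_attains_inf[OF compact_unit_tangent_bundle False
        continuous_on_subset[OF continuous_on_metric[OF assms] unit_tangent_bundle_subset]]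
    by blast
  then show ?thesis
    using that metric_pos[OF assms] unit_tangent_bundle_subset by blast
qed

text \<open>Provides the domination of \<open>F\<close> squared along a loop by a multiple of the
  integrable function \<open>(norm (velocity \<gamma> t))\<^sup>2\<close>.\<close>

lemma metric_upper_bound:
  assumes "F \<in> metrics r"
  obtains C where "C \<ge> 0" and "\<And>x v. (x, v) \<in> slit_tangent_bundle \<Longrightarrow> F (x, v) \<le> C * norm v"
proof -
  have "bdd_above (F ` unit_tangent_bundle)"
    by (intro compact_imp_bounded bounded_imp_bdd_above compact_continuous_image
        compact_unit_tangent_bundle
        continuous_on_subset[OF continuous_on_metric[OF assms] unit_tangent_bundle_subset])
  then obtain C where C: "\<And>z. z \<in> unit_tangent_bundle \<Longrightarrow> F z \<le> C"
    unfolding bdd_above_def by blast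
  show ?thesis
  proof
    \<comment> \<open>If the unit tangent bundle is empty, the bound \<open>C\<close> may be
      negative.\<close>
    show "max C 0 \<ge> 0" by simp
    fix x v :: 'a
    assume xv: "(x, v) \<in> slit_tangent_bundle"
    then have u: "(x, v /\<^sub>R norm v) \<in> unit_tangent_bundle"
      by (auto simp: slit_tangent_bundle_def tangent_bundle_def unit_tangent_bundle_def)
    then have t: "(x, v /\<^sub>R norm v) \<in> tangent_bundle"
      by (auto simp: unit_tangent_bundle_def)
    have "v \<noteq> 0" using xv by (simp add: slit_tangent_bundle_def)
    then have "F (x, v) = norm v * F (x, v /\<^sub>R norm v)"
      using metric_homogeneous[OF assms t, of "norm v"] by simp
    also have "\<dots> \<le> norm v * max C 0"
      using C[OF u] by (intro mult_left_mono) auto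
    finally show "F (x, v) \<le> max C 0 * norm v" by (simp add: mult.commute)
  qed
qed


section \<open>Energy\<close>

text \<open>Differentiating the constant function \<open>\<gamma> s \<bullet> \<gamma> s\<close>
  shows that the velocity is orthogonal to the position.\<close>

lemma loop_tangent:
  fixes \<gamma> :: "real \<Rightarrow> 'a::euclidean_space"
  assumes "\<gamma> \<in> loops" and "\<gamma> differentiable (at t)"
  shows "(\<gamma> t, velocity \<gamma> t) \<in> tangent_bundle"
proof -
  have sph: "norm (\<gamma> s) = 1" for s
    using assms(1) by (auto simp: loops_def)
  then have const: "\<gamma> s \<bullet> \<gamma> s = 1" for s
    by (simp add: dot_square_norm)
  have "(\<gamma> has_vector_derivative velocity \<gamma> t) (at t)"
    using assms(2) by (simp add: vector_derivative_works)
  then have "((\<lambda>s. \<gamma> s \<bullet> \<gamma> s) has_vector_derivative (\<gamma> t \<bullet> velocity \<gamma> t + velocity \<gamma> t \<bullet> \<gamma> t)) (at t)"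
    using bounded_bilinear.has_vector_derivative[OF bounded_bilinear_inner] by blast
  moreover have "((\<lambda>s. \<gamma> s \<bullet> \<gamma> s) has_vector_derivative 0) (at t)"
    by (simp add: const)
  ultimately have "\<gamma> t \<bullet> velocity \<gamma> t + velocity \<gamma> t \<bullet> \<gamma> t = 0"
    by (rule vector_derivative_unique_at)
  then show ?thesis
    using sph by (auto simp: tangent_bundle_def inner_commute)
qed

lemma AE_loop_tangent:
  assumes "\<gamma> \<in> loops"
  shows "AE t in lebesgue. (\<gamma> t, velocity \<gamma> t) \<in> tangent_bundle"
proof -
  have "AE t in lebesgue. \<gamma> differentiable (at t)"
    using assms unfolding loops_def by blast
  then show ?thesis
    by eventually_elim (rule loop_tangent[OF assms])
qed

text \<open>Continuity is not part of \<open>loops\<close>; it follows because the loop is an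
  indefinite integral of its velocity.\<close>

lemma continuous_on_loop:
  fixes \<gamma> :: "real \<Rightarrow> 'a::euclidean_space"
  assumes "\<gamma> \<in> loops"
  shows "continuous_on {0..1} \<gamma>"
proof -
  have int: "set_integrable lebesgue {0..1} (velocity \<gamma>)"
    and rep: "\<And>t. t \<in> {0..1} \<Longrightarrow> \<gamma> t = \<gamma> 0 + (LINT s:{0..t}|lebesgue. velocity \<gamma> s)"
    using assms unfolding loops_def by blast+
  have "continuous_on {0..1} (\<lambda>t. \<gamma> 0 + integral {0..t} (velocity \<gamma>))"
    using indefinite_integral_continuous_1[OF set_lebesgue_integral_eq_integral(1)[OF int]]
    by (intro continuous_intros)
  moreover have "\<gamma> 0 + integral {0..t} (velocity \<gamma>) = \<gamma> t" if "t \<in> {0..1}" for t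
  proof -
    have "set_integrable lebesgue {0..t} (velocity \<gamma>)"
      using that by (intro set_integrable_subset[OF int]) auto
    then show ?thesis
      using rep[OF that] by (simp add: set_lebesgue_integral_eq_integral)
  qed
  ultimately show ?thesis
    by (rule continuous_on_eq)
qed

text \<open>Integrals of non-integrable functions default to zero, so comparing energies requires
  this first. The integrand agrees almost everywhere with a Borel function of position and velocity,
  which is dominated by a multiple of the squared speed.\<close>

lemma set_integrable_metric_loop:
  fixes \<gamma> :: "real \<Rightarrow> 'a::euclidean_space"
  assumes F: "F \<in> metrics r" and \<gamma>: "\<gamma> \<in> loops"
  shows "set_integrable lebesgue {0..1} (\<lambda>t. (F (\<gamma> t, velocity \<gamma> t))\<^sup>2)"
proof -
  \<comment> \<open>\<open>F\<close> is continuous on the slit bundle but \<open>undefined\<close>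
    off the tangent bundle; cutting off there gives a Borel function on the whole ambient
    space.\<close>
  define H where "H z = indicator slit_tangent_bundle z *\<^sub>R (F z)\<^sup>2" for z :: "'a \<times> 'a"
  \<comment> \<open>Position and velocity are cut off too, because their measurability is derived on
    the unit interval.\<close>
  define c where "c t = indicator {0..1} t *\<^sub>R \<gamma> t" for t :: real
  define w where "w t = indicator {0..1} t *\<^sub>R velocity \<gamma> t" for t :: real
  have H: "H \<in> borel_measurable borel"
    unfolding H_def
    by (intro borel_measurable_continuous_on_indicator borel_slit_tangent_bundle continuous_intros
        continuous_on_metric[OF F])
  have "c \<in> borel_measurable borel"
    unfolding c_def by (intro borel_measurable_continuous_on_indicator continuous_on_loop[OF \<gamma>]) auto
  then have c: "c \<in> borel_measurable lebesgue"
    by (simp add: measurable_completion)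
  have w: "w \<in> borel_measurable lebesgue"
    using \<gamma> unfolding w_def loops_def set_integrable_def by (auto dest: borel_measurable_integrable)
  have "(\<lambda>t. (c t, w t)) \<in> borel_measurable lebesgue"
    using c w by (rule borel_measurable_Pair)
  then have Hm: "(\<lambda>t. H (c t, w t)) \<in> borel_measurable lebesgue"
    by (rule measurable_compose[OF _ H])
  obtain C where C: "C \<ge> 0" "\<And>x v. (x, v) \<in> slit_tangent_bundle \<Longrightarrow> F (x, v) \<le> C * norm v"
    using metric_upper_bound[OF F] by blast
  have bound: "\<bar>H (c t, w t)\<bar> \<le> C\<^sup>2 * (norm (w t))\<^sup>2" for t
  proof (cases "(c t, w t) \<in> slit_tangent_bundle")
    case True
    have "(F (c t, w t))\<^sup>2 \<le> (C * norm (w t))\<^sup>2"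
      using C(2)[OF True] metric_pos[OF F True] by (intro power_mono) auto
    with True show ?thesis by (simp add: H_def power_mult_distrib)
  qed (simp add: H_def)
  have "integrable lebesgue (\<lambda>t. indicator {0..1} t *\<^sub>R (norm (velocity \<gamma> t))\<^sup>2)"
    using \<gamma> unfolding loops_def set_integrable_def by blast
  also have "(\<lambda>t. indicator {0..1} t *\<^sub>R (norm (velocity \<gamma> t))\<^sup>2) = (\<lambda>t. (norm (w t))\<^sup>2)"
    by (auto simp: w_def fun_eq_iff indicator_def)
  finally have "integrable lebesgue (\<lambda>t. C\<^sup>2 * (norm (w t))\<^sup>2)"
    by simp
  then have "integrable lebesgue (\<lambda>t. H (c t, w t))"
    by (rule Bochner_Integration.integrable_bound[OF _ Hm]) (use bound in auto)
  \<comment> \<open>Outside the unit interval the cut-off velocity is zero, so the pair leaves the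
    slit bundle and \<open>H\<close> vanishes.\<close>
  moreover have "(\<lambda>t. H (c t, w t)) = (\<lambda>t. indicator {0..1} t *\<^sub>R H (\<gamma> t, velocity \<gamma> t))"
    by (auto simp: fun_eq_iff c_def w_def indicator_def H_def slit_tangent_bundle_def)
  ultimately have int: "set_integrable lebesgue {0..1} (\<lambda>t. H (\<gamma> t, velocity \<gamma> t))"
    by (simp add: set_integrable_def)
  obtain N where N: "N \<in> null_sets lebesgue" "{t. (\<gamma> t, velocity \<gamma> t) \<notin> tangent_bundle} \<subseteq> N"
    using AE_loop_tangent[OF \<gamma>] by (auto simp: eventually_ae_filter)
  \<comment> \<open>On the tangent bundle \<open>H\<close> equals \<open>F\<close> squared, since
    \<open>F\<close> vanishes on zero vectors; the remaining times form a null set.\<close>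
  show ?thesis
  proof (rule absolutely_integrable_spike[OF int])
    show "negligible N" using N(1) by (simp add: negligible_iff_null_sets)
    fix t assume "t \<in> {0..1} - N"
    then have "(\<gamma> t, velocity \<gamma> t) \<in> tangent_bundle" using N(2) by auto
    then show "(F (\<gamma> t, velocity \<gamma> t))\<^sup>2 = H (\<gamma> t, velocity \<gamma> t)"
      using metric_zero[OF F, of "\<gamma> t"]
      by (auto simp: H_def slit_tangent_bundle_def tangent_bundle_def indicator_def)
  qed
qed

text \<open>Nonnegativity of \<open>F'\<close> on tangent vectors allows squaring the pointwise
  inequality. It holds at almost every time, which suffices because both integrands are
  integrable.\<close>

lemma sqrt_energy_mono:
  assumes F: "F \<in> metrics r" and F': "F' \<in> metrics r" and "\<gamma> \<in> loops" and "k \<ge> 0"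
    and le: "\<And>z. z \<in> tangent_bundle \<Longrightarrow> F' z \<le> k * F z"
  shows "sqrt_energy F' \<gamma> \<le> k * sqrt_energy F \<gamma>"
proof -
  have "(LINT t:{0..1}|lebesgue. (F' (\<gamma> t, velocity \<gamma> t))\<^sup>2)
      \<le> (LINT t:{0..1}|lebesgue. k\<^sup>2 * (F (\<gamma> t, velocity \<gamma> t))\<^sup>2)"
  proof (rule set_integral_mono_AE)
    show "AE t\<in>{0..1} in lebesgue. (F' (\<gamma> t, velocity \<gamma> t))\<^sup>2 \<le> k\<^sup>2 * (F (\<gamma> t, velocity \<gamma> t))\<^sup>2"
      using AE_loop_tangent[OF \<open>\<gamma> \<in> loops\<close>]
    proof eventually_elim
      case (elim t)
      then have "(F' (\<gamma> t, velocity \<gamma> t))\<^sup>2 \<le> (k * F (\<gamma> t, velocity \<gamma> t))\<^sup>2"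
        by (intro power_mono le metric_nonneg[OF F'])
      then show ?case by (simp add: power_mult_distrib)
    qed
  qed (use assms in \<open>auto intro!: set_integrable_metric_loop set_integrable_mult_right\<close>)
  then have "sqrt_energy F' \<gamma> \<le> sqrt (k\<^sup>2 * (LINT t:{0..1}|lebesgue. (F (\<gamma> t, velocity \<gamma> t))\<^sup>2))"
    unfolding sqrt_energy_def by simp
  then show ?thesis
    using \<open>k \<ge> 0\<close> by (simp add: sqrt_energy_def real_sqrt_mult)
qed


section \<open>Critical levels\<close>

lemma gboundary_superset:
  assumes "finite S" and "Poly_Mapping.keys c \<subseteq> S"
  shows "gboundary (Suc p) c = (\<Sum>f\<in>S. \<Sum>k\<le>Suc p.
    Poly_Mapping.single (singular_face (Suc p) k f) ((-1) ^ k * Poly_Mapping.lookup c f))"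
  unfolding gboundary_def using assms
  by (simp del: sum.atMost_Suc) (intro sum.mono_neutral_left; simp add: in_keys_iff)

text \<open>Each boundary sums over the support of its own chain, and supports may cancel in a sum.
  All three sums are extended to the union of supports, where the new terms have coefficient
  zero.\<close>

lemma gboundary_add:
  "gboundary (Suc p) (c + d) = gboundary (Suc p) c + gboundary (Suc p) d"
proof -
  let ?S = "Poly_Mapping.keys c \<union> Poly_Mapping.keys d"
  have "finite ?S" "Poly_Mapping.keys (c + d) \<subseteq> ?S"
    by (simp_all add: Poly_Mapping.keys_add)
  then show ?thesis
    by (simp add: gboundary_superset[of ?S] lookup_add distrib_left single_add sum.distrib
        del: sum.atMost_Suc)
qed

lemma zero_in_gboundaries: "0 \<in> gboundaries p X"
  unfolding gboundaries_def by (rule image_eqI[of _ _ 0]) (simp_all add: gboundary_def gchains_def)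

lemma gboundaries_add:
  assumes "b \<in> gboundaries p X" and "b' \<in> gboundaries p X"
  shows "b + b' \<in> gboundaries p X"
proof -
  obtain c c' where "c \<in> gchains (Suc p) X" "c' \<in> gchains (Suc p) X"
    and b: "b = gboundary (Suc p) c" "b' = gboundary (Suc p) c'"
    using assms by (auto simp: gboundaries_def)
  then have "c + c' \<in> gchains (Suc p) X"
    unfolding gchains_def using Poly_Mapping.keys_add[of c c'] by blast
  then show ?thesis
    unfolding b gboundary_add[symmetric] gboundaries_def by blast
qed

text \<open>The inclusion is asked for inside \<open>topspace X\<close> only, because energies are
  compared for loops and not for arbitrary functions.\<close>

lemma gchains_mono:
  assumes "topspace X \<inter> S \<subseteq> T"
  shows "gchains p (subtopology X S) \<subseteq> gchains p (subtopology X T)"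
proof -
  have "singular_simplex p (subtopology X T) f"
    if "singular_simplex p (subtopology X (topspace X \<inter> S)) f" for f
    using that assms unfolding singular_simplex_subtopology by blast
  then show ?thesis
    unfolding subtopology_restrict by (auto simp: gchains_def)
qed

lemma gcycles_mono:
  "topspace X \<inter> S \<subseteq> T \<Longrightarrow> gcycles p (subtopology X S) \<subseteq> gcycles p (subtopology X T)"
  using gchains_mono[of X S T p] by (auto simp: gcycles_def)

text \<open>The boundaries of \<open>X\<close> contain those of the subspace, contain zero and are
  closed under addition, so adding them absorbs the smaller set and keeps the
  representative.\<close>

lemma ghom_incl_coset:
  fixes z :: "('x, 'g::field) gchain"
  shows "ghom_incl p X (z +o gboundaries p (subtopology X S)) = z +o gboundaries p X"
proof -
  let ?B = "gboundaries p :: 'x topology \<Rightarrow> ('x, 'g) gchain set"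
  have "?B (subtopology X S) \<subseteq> ?B X"
    unfolding gboundaries_def using gchains_mono[of X S UNIV "Suc p"]
    by (intro image_mono) simp
  then have "?B (subtopology X S) + ?B X = ?B X"
    using gboundaries_add zero_in_gboundaries[of p "subtopology X S"]
    by (intro equalityI set_zero_plus2) (blast elim: set_plus_elim)+
  then show ?thesis
    by (simp add: ghom_incl_def set_plus_rearrange3)
qed

text \<open>A class comes from the subspace exactly when some cycle in the subspace represents it;
  in this form monotonicity in the subspace is immediate.\<close>

lemma ghom_incl_image:
  "ghom_incl p X ` ghomology p (subtopology X S) =
    (\<lambda>z. z +o gboundaries p X) ` gcycles p (subtopology X S)"
  by (simp add: ghomology_def image_image ghom_incl_coset)

lemma topspace_loop_space: "topspace loop_space \<subseteq> loops"
  by (auto simp: loop_space_def topology_generated_by_topspace)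

lemma ghom_incl_sublevel_mono:
  assumes "\<And>\<gamma>. \<gamma> \<in> loops \<Longrightarrow> sqrt_energy F \<gamma> \<le> a \<Longrightarrow> sqrt_energy F' \<gamma> \<le> b"
  shows "ghom_incl p loop_space ` ghomology p (sublevel F a)
    \<subseteq> ghom_incl p loop_space ` ghomology p (sublevel F' b)"
  unfolding sublevel_def ghom_incl_image
  using assms topspace_loop_space by (intro image_mono gcycles_mono) auto

text \<open>This also covers classes supported in no sublevel set, for which both critical levels are
  the junk value \<open>Inf {}\<close>; this is the reason for the second absolute value.\<close>

lemma critical_level_close:
  fixes X :: "(real \<Rightarrow> 'a::euclidean_space, 'g::field) gchain set"
  assumes F: "F \<in> metrics r" and F': "F' \<in> metrics r" and "0 \<le> \<epsilon>" and "\<epsilon> < 1"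
    and close: "\<And>z. z \<in> unit_tangent_bundle \<Longrightarrow> \<bar>F' z - F z\<bar> \<le> \<epsilon> * F z"
  shows "\<bar>critical_level F' p X - critical_level F p X\<bar> \<le> \<epsilon> * \<bar>critical_level F p X\<bar>"
proof -
  define A where "A F = {a. 0 \<le> a \<and> X \<in> ghom_incl p loop_space ` ghomology p (sublevel F a)}" for F
  have cl: "critical_level F p X = Inf (A F)" for F
    by (simp add: critical_level_def A_def)
  have bdd: "bdd_below (A F)" for F
    unfolding bdd_below_def A_def by blast
  have Inf_nonneg: "0 \<le> Inf (A F)" if "A F \<noteq> {}" for F
    using that by (intro cInf_greatest) (auto simp: A_def)
  \<comment> \<open>A pointwise factor \<open>k\<close> between the metrics carries every admissible
    level of one to \<open>k\<close> times that level for the other.\<close>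
  have A_mono: "k * a \<in> A G'"
    if "G \<in> metrics r" "G' \<in> metrics r" "k \<ge> 0" "a \<in> A G"
      and le: "\<And>z. z \<in> unit_tangent_bundle \<Longrightarrow> G' z \<le> k * G z" for G G' k a
  proof -
    have "sqrt_energy G' \<gamma> \<le> k * a" if "\<gamma> \<in> loops" "sqrt_energy G \<gamma> \<le> a" for \<gamma>
      using sqrt_energy_mono[OF \<open>G \<in> metrics r\<close> \<open>G' \<in> metrics r\<close> that(1) \<open>k \<ge> 0\<close>
          metric_mono_unit_tangent_bundle[OF \<open>G \<in> metrics r\<close> \<open>G' \<in> metrics r\<close> le]]
        mult_left_mono[OF that(2) \<open>k \<ge> 0\<close>] by force
    then have "ghom_incl p loop_space ` ghomology p (sublevel G a)
        \<subseteq> (ghom_incl p loop_space ` ghomology p (sublevel G' (k * a))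
          :: (real \<Rightarrow> 'a, 'g) gchain set set)"
      by (rule ghom_incl_sublevel_mono)
    then show ?thesis
      using that(3,4) unfolding A_def by (blast intro: mult_nonneg_nonneg)
  qed
  have up: "(1 + \<epsilon>) * a \<in> A F'" if "a \<in> A F" for a
  proof (rule A_mono[OF F F' _ that])
    show "F' z \<le> (1 + \<epsilon>) * F z" if "z \<in> unit_tangent_bundle" for z
      using close[OF that] by (simp add: algebra_simps)
  qed (use \<open>0 \<le> \<epsilon>\<close> in simp)
  \<comment> \<open>Closeness gives \<open>(1 - \<epsilon>) * F z \<le> F' z\<close>, and
    \<open>\<epsilon> < 1\<close> permits dividing by the factor.\<close>
  have down: "inverse (1 - \<epsilon>) * a \<in> A F" if "a \<in> A F'" for a
  proof (rule A_mono[OF F' F _ that])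
    show "F z \<le> inverse (1 - \<epsilon>) * F' z" if "z \<in> unit_tangent_bundle" for z
      using close[OF that] \<open>\<epsilon> < 1\<close> by (simp add: field_simps)
  qed (use \<open>\<epsilon> < 1\<close> in simp)
  show ?thesis
  proof (cases "A F = {}")
    case True
    \<comment> \<open>Emptiness passes from one metric to the other, so both infima are the same
      default value and the difference is zero.\<close>
    then have "A F' = {}" using down by blast
    with True show ?thesis using \<open>0 \<le> \<epsilon>\<close> by (simp add: cl)
  next
    case False
    then have ne': "A F' \<noteq> {}" using up by blast
    \<comment> \<open>Moving the factor to this side makes the claim a lower bound for
      \<open>A F\<close>, as the greatest lower bound property requires.\<close>
    have "Inf (A F') / (1 + \<epsilon>) \<le> Inf (A F)"
    proof (rule cInf_greatest[OF False])
      fix a assume "a \<in> A F"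
      then have "Inf (A F') \<le> (1 + \<epsilon>) * a" using up bdd cInf_lower by blast
      then show "Inf (A F') / (1 + \<epsilon>) \<le> a" using \<open>0 \<le> \<epsilon>\<close> by (simp add: field_simps)
    qed
    moreover have "Inf (A F) * (1 - \<epsilon>) \<le> Inf (A F')"
    proof (rule cInf_greatest[OF ne'])
      fix a assume "a \<in> A F'"
      then have "Inf (A F) \<le> inverse (1 - \<epsilon>) * a" using down bdd cInf_lower by blast
      then show "Inf (A F) * (1 - \<epsilon>) \<le> a" using \<open>\<epsilon> < 1\<close> by (simp add: field_simps)
    qed
    ultimately show ?thesis
      using Inf_nonneg[OF False] \<open>0 \<le> \<epsilon>\<close> by (simp add: cl field_simps abs_le_iff)
  qed
qed


section \<open>The global mean frequency\<close>

abbreviation nontrivial_classes ::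
    "nat \<Rightarrow> 'x topology \<Rightarrow> ('x, 'g::field) gchain set set" where
  "nontrivial_classes p X \<equiv> ghomology p X - {gboundaries p X}"

lemma resonant_iff:
  fixes F :: "'a::euclidean_space \<times> 'a \<Rightarrow> real" and G :: "'g::field itself"
  shows "resonant G F \<alpha> \<longleftrightarrow> 0 < \<alpha> \<and>
    (\<exists>B. \<forall>p. \<forall>X\<in>(nontrivial_classes p loop_space :: (real \<Rightarrow> 'a, 'g) gchain set set).
      \<bar>real p - \<alpha> * critical_level F p X\<bar> \<le> B)"
  unfolding resonant_def bounded_real by blast

text \<open>If the levels were bounded, replacing \<open>\<alpha>\<close> by
  \<open>\<alpha> + 1\<close> would change the resonance expression by a bounded amount. Then
  \<open>\<alpha> + 1\<close> would also be resonant, against uniqueness. Thus no computation of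
  loop space homology enters.\<close>

lemma critical_level_unbounded:
  fixes F :: "'a::euclidean_space \<times> 'a \<Rightarrow> real" and G :: "'g::field itself"
  assumes "is_global_mean_frequency G F \<alpha>"
  shows "\<exists>p. \<exists>X\<in>(nontrivial_classes p loop_space :: (real \<Rightarrow> 'a, 'g) gchain set set).
    C < \<bar>critical_level F p X\<bar>"
proof (rule ccontr)
  let ?H = "\<lambda>p. nontrivial_classes p loop_space :: (real \<Rightarrow> 'a, 'g) gchain set set"
  assume "\<not> ?thesis"
  then have C: "\<bar>critical_level F p X\<bar> \<le> C" if "X \<in> ?H p" for p X
    using that by (meson not_le)
  have res: "resonant G F \<alpha>" and uniq: "\<forall>\<beta>. resonant G F \<beta> \<longrightarrow> \<beta> = \<alpha>"
    using assms unfolding is_global_mean_frequency_def by blast+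
  have "0 < \<alpha>" using res unfolding resonant_def by blast
  obtain B where B: "\<forall>p. \<forall>X\<in>?H p. \<bar>real p - \<alpha> * critical_level F p X\<bar> \<le> B"
    using res unfolding resonant_iff by blast
  have "\<bar>real p - (\<alpha> + 1) * critical_level F p X\<bar> \<le> B + C" if "X \<in> ?H p" for p X
  proof -
    have "\<bar>real p - \<alpha> * critical_level F p X\<bar> \<le> B" using B that by blast
    with C[OF that] show ?thesis unfolding distrib_right by linarith
  qed
  then have "\<exists>B. \<forall>p. \<forall>X\<in>?H p. \<bar>real p - (\<alpha> + 1) * critical_level F p X\<bar> \<le> B"
    by blast
  with \<open>0 < \<alpha>\<close> have "resonant G F (\<alpha> + 1)"
    unfolding resonant_iff by simp
  then have "\<alpha> + 1 = \<alpha>" using uniq by blast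
  then show False by simp
qed

text \<open>For one class the degree cancels between the two estimates, which bounds
  \<open>\<alpha>' * cr' - \<alpha> * cr\<close>. Replacing \<open>cr'\<close> by \<open>cr\<close>
  costs a term weighted by \<open>\<alpha>'\<close>, hence the asymmetric right-hand side.\<close>

lemma mean_frequency_close:
  fixes F F' :: "'a::euclidean_space \<times> 'a \<Rightarrow> real" and G :: "'g::field itself"
  assumes F: "is_global_mean_frequency G F \<alpha>"
    and F': "resonant G F' \<alpha>'"
    and close: "\<And>p (X :: (real \<Rightarrow> 'a, 'g) gchain set).
      \<bar>critical_level F' p X - critical_level F p X\<bar> \<le> \<epsilon> * \<bar>critical_level F p X\<bar>"
  shows "\<bar>\<alpha>' - \<alpha>\<bar> \<le> \<epsilon> * \<alpha>'"
proof (rule ccontr)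
  assume "\<not> \<bar>\<alpha>' - \<alpha>\<bar> \<le> \<epsilon> * \<alpha>'"
  then have d: "\<bar>\<alpha>' - \<alpha>\<bar> - \<epsilon> * \<alpha>' > 0" (is "?d > 0") by simp
  have "\<alpha>' > 0" using F' by (simp add: resonant_def)
  let ?H = "\<lambda>p. nontrivial_classes p loop_space :: (real \<Rightarrow> 'a, 'g) gchain set set"
  obtain B where B: "\<forall>p. \<forall>X\<in>?H p. \<bar>real p - \<alpha> * critical_level F p X\<bar> \<le> B"
    using F unfolding is_global_mean_frequency_def resonant_iff[of G F \<alpha>] by blast
  obtain B' where B': "\<forall>p. \<forall>X\<in>?H p. \<bar>real p - \<alpha>' * critical_level F' p X\<bar> \<le> B'"
    using F' unfolding resonant_iff by blast
  \<comment> \<open>The threshold is chosen so that the supposed gap times the level exceeds the sum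
    of the two resonance constants.\<close>
  obtain p X where X: "X \<in> ?H p" and large: "(B + B') / ?d < \<bar>critical_level F p X\<bar>"
    using critical_level_unbounded[OF F] by blast
  let ?c = "critical_level F p X" and ?c' = "critical_level F' p X"
  have "\<bar>\<alpha>' - \<alpha>\<bar> * \<bar>?c\<bar> = \<bar>(\<alpha>' * ?c' - \<alpha> * ?c) - \<alpha>' * (?c' - ?c)\<bar>"
    by (simp add: algebra_simps flip: abs_mult)
  also have "\<dots> \<le> \<bar>\<alpha>' * ?c' - \<alpha> * ?c\<bar> + \<bar>\<alpha>' * (?c' - ?c)\<bar>"
    by (rule abs_triangle_ineq4)
  also have "\<bar>\<alpha>' * ?c' - \<alpha> * ?c\<bar> \<le> B + B'"
    using B[rule_format, OF X] B'[rule_format, OF X] by linarith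
  also have "\<bar>\<alpha>' * (?c' - ?c)\<bar> \<le> \<alpha>' * (\<epsilon> * \<bar>?c\<bar>)"
    using close[of p X] \<open>\<alpha>' > 0\<close> by (simp add: abs_mult)
  finally have "?d * \<bar>?c\<bar> \<le> B + B'"
    by (simp add: algebra_simps)
  moreover have "?d * \<bar>?c\<bar> > B + B'"
    using large d by (simp add: pos_divide_less_eq mult.commute)
  ultimately show False by simp
qed

section \<open>Neighbourhoods of a metric and continuity of the mean frequency\<close>

lemma topspace_metrics_topology: "topspace (metrics_topology r) \<subseteq> metrics r"
  by (auto simp: metrics_topology_def topology_generated_by_topspace)

text \<open>A generating open set with compact set the unit tangent bundle and tolerance
  \<open>\<epsilon> * m\<close>, where \<open>m\<close> bounds \<open>F\<close> below there, turns
  an absolute error into a relative one.\<close>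

lemma metrics_neighbourhood:
  assumes F: "F \<in> metrics r" and "\<epsilon> > 0"
  obtains U where "openin (metrics_topology r) U" and "F \<in> U" and "U \<subseteq> metrics r"
    and "\<And>F' z. F' \<in> U \<Longrightarrow> z \<in> unit_tangent_bundle \<Longrightarrow> \<bar>F' z - F z\<bar> \<le> \<epsilon> * F z"
proof -
  obtain m where m: "m > 0" "\<And>z. z \<in> unit_tangent_bundle \<Longrightarrow> m \<le> F z"
    using metric_lower_bound[OF F] by blast
  define U where "U = {F' \<in> metrics r. \<forall>us. set us \<subseteq> Basis \<and> length us \<le> r \<longrightarrow>
    (\<forall>z\<in>unit_tangent_bundle.
      \<bar>iterated_deriv us (ambient F') z - iterated_deriv us (ambient F) z\<bar> < \<epsilon> * m)}"
  show ?thesis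
  proof
    show "openin (metrics_topology r) U"
      unfolding metrics_topology_def
    proof (intro topology_generated_by_Basis CollectI exI conjI)
      show "F \<in> metrics r" by (fact F)
      show "0 < \<epsilon> * m" using m(1) \<open>\<epsilon> > 0\<close> by simp
    qed (rule U_def compact_unit_tangent_bundle unit_tangent_bundle_subset)+
    show "F \<in> U" using F m(1) \<open>\<epsilon> > 0\<close> by (simp add: U_def)
    show "U \<subseteq> metrics r" by (auto simp: U_def)
    fix F' and z :: "'a \<times> 'a"
    assume F': "F' \<in> U" and z: "z \<in> unit_tangent_bundle"
    \<comment> \<open>The empty list of directions is the derivative of order zero, that is, the
      function itself.\<close>
    then have "\<bar>ambient F' z - ambient F z\<bar> < \<epsilon> * m"
      unfolding U_def by (auto dest: spec[of _ "[]"])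
    also have "\<epsilon> * m \<le> \<epsilon> * F z" using m(2)[OF z] \<open>\<epsilon> > 0\<close> by simp
    finally show "\<bar>F' z - F z\<bar> \<le> \<epsilon> * F z"
      using ambient_slit_tangent_bundle subsetD[OF unit_tangent_bundle_subset z]
      by (metis less_imp_le)
  qed
qed

theorem lemma1p6:
  fixes n r :: nat
    and \<alpha> :: "('a::euclidean_space \<times> 'a \<Rightarrow> real) \<Rightarrow> real"
  assumes "DIM('a) = n + 1" and "n > 2" and "r \<ge> 2"
    and "\<And>F. F \<in> metrics r \<Longrightarrow> is_global_mean_frequency TYPE('g::field) F (\<alpha> F)"
  shows "continuous_map (metrics_topology r) euclideanreal \<alpha>"
  unfolding mtopology_is_euclidean[symmetric] Met_TC.continuous_map_to_metric
proof (intro ballI allI impI)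
  fix F :: "'a \<times> 'a \<Rightarrow> real" and e :: real
  assume "F \<in> topspace (metrics_topology r)" and "e > 0"
  then have F: "F \<in> metrics r" using topspace_metrics_topology by blast
  have pos: "\<alpha> F > 0"
    using assms(4)[OF F] by (simp add: is_global_mean_frequency_def resonant_def)
  \<comment> \<open>With \<open>d\<close> the change in frequency, the estimate will read \<open>d
    \<le> \<epsilon> * \<alpha> F + \<epsilon> * d \<le> e / 3 + d / 2\<close>, so
    \<open>d \<le> 2 * e / 3\<close>. The bound 1/2 also ensures
    \<open>\<epsilon> < 1\<close>.\<close>
  define \<epsilon> where "\<epsilon> = min (1 / 2) (e / (3 * \<alpha> F))"
  have \<epsilon>: "\<epsilon> > 0" "\<epsilon> \<le> 1 / 2" "\<epsilon> * \<alpha> F \<le> e / 3"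
    using pos \<open>e > 0\<close> by (auto simp: \<epsilon>_def min_def field_simps)
  obtain U where U: "openin (metrics_topology r) U" "F \<in> U" "U \<subseteq> metrics r"
    and close: "\<And>F' z. F' \<in> U \<Longrightarrow> z \<in> unit_tangent_bundle \<Longrightarrow> \<bar>F' z - F z\<bar> \<le> \<epsilon> * F z"
    using metrics_neighbourhood[OF F \<epsilon>(1)] by blast
  have "\<bar>\<alpha> F' - \<alpha> F\<bar> < e" if "F' \<in> U" for F'
  proof -
    have F': "F' \<in> metrics r" using that U(3) by blast
    define d where "d = \<bar>\<alpha> F' - \<alpha> F\<bar>"
    have le: "d \<le> \<epsilon> * \<alpha> F'"
      unfolding d_def
    proof (rule mean_frequency_close[OF assms(4)[OF F]])
      show "resonant TYPE('g) F' (\<alpha> F')"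
        using assms(4)[OF F'] by (simp add: is_global_mean_frequency_def)
    qed (rule critical_level_close[OF F F' _ _ close[OF that]], use \<epsilon> in auto)
    \<comment> \<open>The bound so far involves the unknown \<open>\<alpha> F'\<close>; using
      \<open>\<alpha> F' \<le> \<alpha> F + d\<close> makes it depend on \<open>F\<close> and
      \<open>d\<close>, and the \<open>d\<close> term is then absorbed on the left.\<close>
    have *: "\<epsilon> * \<alpha> F' \<le> \<epsilon> * \<alpha> F + \<epsilon> * d"
      using \<epsilon>(1) by (simp add: d_def mult_left_mono flip: distrib_left)
    have "\<epsilon> * d \<le> 1 / 2 * d"
      using \<epsilon>(2) by (intro mult_right_mono) (auto simp: d_def)
    then show ?thesis unfolding d_def[symmetric] using * le \<epsilon>(3) \<open>e > 0\<close> by linarith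
  qed
  then show "\<exists>U. openin (metrics_topology r) U \<and> F \<in> U \<and> (\<forall>y\<in>U. \<alpha> y \<in> Met_TC.mball (\<alpha> F) e)"
    using U by (intro exI[of _ U]) (auto simp: dist_real_def abs_minus_commute)
qed

end
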